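(* Let $k\ge 4$ be an even integer and let $m\ge 2$ be an integer with $m\equiv -1\pmod k$. Suppose $P^{-}(m)\ge k$, where $P^{-}(m)$ is the least prime factor of $m$. Let \[ D=\Bigl\{0,1,\dots,\Bigl\lfloor \tfrac{k-2}{k}m\Bigr\rfloor,\ \tfrac{(k-1)m-1}{k}\Bigr\}\subseteq\mathbb{Z}_m, \] and let $n$ be a positive integer divisible by $\lfloor \frac{k-2}{k}m\rfloor+2$. Then $S(D,n)$ contains no arithmetic progression of length $k$.
   Context: $\mathbb{Z}_m=\mathbb{Z}/m\mathbb{Z}$. For a set $D=\{d_1,\dots,d_{|D|}\}\subseteq\mathbb{Z}_m$ and a positive integer $n$ with $|D|\mid n$, define \[ S(D,n)=\{(v_1,\dots,v_n)\in\mathbb{Z}_m^n : \text{for each } i\le |D|,\ v_j=d_i \text{ for exactly } n/|D| \text{ indices } j\}, \] i.e. the vectors all of whose coordinates lie in $D$ and in which every element of $D$ occurs equally often. An arithmetic progression of length $k$ in $\mathbb{Z}_m^n$ is a sequence $\mathbf{v},\mathbf{v}+\mathbf{c},\dots,\mathbf{v}+(k-1)\mathbf{c}$ with $\mathbf{c}\neq 0$. *)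

theory Defs
  imports Complex_Main "HOL-Number_Theory.Residues" "HOL-Library.FuncSet"
begin

text \<open>\<open>\<int>\<^sub>m\<^sup>n\<close>: vectors are extensional functions on the index set \<open>{..<n}\<close> with values in the
  canonical representatives \<open>{0..m - 1}\<close>, i.e. the carrier of the residue ring.\<close>

definition Zvec :: "nat \<Rightarrow> nat \<Rightarrow> (nat \<Rightarrow> int) set" where
  "Zvec m n = {..<n} \<rightarrow>\<^sub>E carrier (residue_ring (int m))"

definition Zvec_zero :: "nat \<Rightarrow> nat \<Rightarrow> nat \<Rightarrow> int" where
  "Zvec_zero m n = (\<lambda>j\<in>{..<n}. \<zero>\<^bsub>residue_ring (int m)\<^esub>)"

definition Zvec_add :: "nat \<Rightarrow> nat \<Rightarrow> (nat \<Rightarrow> int) \<Rightarrow> (nat \<Rightarrow> int) \<Rightarrow> nat \<Rightarrow> int" where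
  "Zvec_add m n u v = (\<lambda>j\<in>{..<n}. u j \<oplus>\<^bsub>residue_ring (int m)\<^esub> v j)"

definition Zvec_mult :: "nat \<Rightarrow> nat \<Rightarrow> nat \<Rightarrow> (nat \<Rightarrow> int) \<Rightarrow> nat \<Rightarrow> int" where
  "Zvec_mult m n i v = (\<lambda>j\<in>{..<n}. [i] \<cdot>\<^bsub>residue_ring (int m)\<^esub> v j)"

text \<open>Meaningful only if \<open>D\<close> is a nonempty set of representatives in \<open>{0..m - 1}\<close> and
  \<open>card D\<close> divides \<open>n\<close>; the multiplicities then add up to \<open>n\<close>, so all coordinates lie in \<open>D\<close>.\<close>

definition S :: "nat \<Rightarrow> int set \<Rightarrow> nat \<Rightarrow> (nat \<Rightarrow> int) set" where
  "S m D n = {v \<in> Zvec m n. \<forall>d\<in>D. card {j \<in> {..<n}. v j = d} = n div card D}"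

definition is_AP :: "nat \<Rightarrow> nat \<Rightarrow> nat \<Rightarrow> (nat \<Rightarrow> nat \<Rightarrow> int) \<Rightarrow> bool" where
  "is_AP m n k a \<longleftrightarrow>
     (\<exists>v\<in>Zvec m n. \<exists>c\<in>Zvec m n. c \<noteq> Zvec_zero m n \<and>
        (\<forall>i<k. a i = Zvec_add m n v (Zvec_mult m n i c)))"

definition least_prime_factor :: "nat \<Rightarrow> nat" where
  "least_prime_factor m = Min (prime_factors m)"

text \<open>The quotient \<open>((k - 1) * m - 1) div k\<close> is exact when \<open>m \<equiv> -1\<close> modulo \<open>k\<close>. For
  \<open>k \<ge> 2\<close> and \<open>m \<ge> 2\<close> all elements lie in \<open>{0..m - 1}\<close>, so they are canonical representatives.\<close>

definition Dset :: "nat \<Rightarrow> nat \<Rightarrow> int set" where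
  "Dset k m = {0..\<lfloor>(real k - 2) / real k * real m\<rfloor>} \<union> {((int k - 1) * int m - 1) div int k}"

end

theory Submission
  imports Defs
begin

text \<open>Write \<open>m = k q - 1\<close>, so that \<open>D = {0..(k-2)q - 1} \<union> {d}\<close> with \<open>d = (k-1)q - 1\<close>.  By Dirichlet's
  approximation, every step \<open>c \<noteq> 0\<close> has a multiple \<open>j c\<close> with \<open>1 \<le> j < N\<close> congruent to some \<open>e \<noteq> 0\<close>
  with \<open>|e| \<le> m / N\<close>.  With \<open>N = k\<close> this shows that a coordinate whose progression starts
  at \<open>d\<close> is constant, because \<open>d + e\<close> falls into a gap of \<open>D\<close>.  With \<open>N = k/2\<close> it shows that a
  coordinate whose progression takes its maximal value \<open>x < (k-2)q\<close> at position \<open>k/2\<close> is constant,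
  because one of the terms \<open>j\<close> steps before or after equals \<open>x + |e|\<close>.  As every value is taken
  equally often at each position, a value that forces constancy at one position forces it at
  all of them; so one removes \<open>d\<close>, and then the other values of \<open>D\<close> in decreasing order, from the
  nonconstant coordinates.\<close>

text \<open>Pigeonhole: the residues \<open>r t\<close> of the \<open>N - 1\<close> multiples with
  \<open>1 \<le> t < N\<close> fall into \<open>N\<close> boxes of width \<open>m / N\<close>,
  numbered by \<open>b t\<close>. A residue in the lowest box is small, one in the highest box is
  small after subtracting \<open>m\<close>. Otherwise two residues share one of the
  \<open>N - 2\<close> middle boxes, and their difference is small.\<close>

lemma ex_small_multiple_mod:
  fixes c m :: int and N :: nat
  assumes m: "m > 0" and N: "N \<ge> 2"
  shows "\<exists>j e. 1 \<le> j \<and> j < N \<and> [int j * c = e] (mod m) \<and> \<bar>e\<bar> * int N \<le> m"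
proof -
  define r where "r t = (int t * c) mod m" for t :: nat
  define b where "b t = r t * int N div m" for t
  have r0: "0 \<le> r t" and rm: "r t < m" for t using m by (auto simp: r_def)
  have rc: "[int t * c = r t] (mod m)" for t by (simp add: r_def cong_def)
  have bl: "b t * m \<le> r t * int N" and bu: "r t * int N < b t * m + m" for t
  proof -
    have "b t * m + (r t * int N) mod m = r t * int N" by (simp add: b_def)
    moreover have "0 \<le> (r t * int N) mod m" "(r t * int N) mod m < m" using m by auto
    ultimately show "b t * m \<le> r t * int N" "r t * int N < b t * m + m" by linarith+
  qed
  have b0: "0 \<le> b t" for t using m r0 by (simp add: b_def pos_imp_zdiv_nonneg_iff)
  have bN: "b t < int N" for t
  proof -
    have "r t * int N < int N * m" using rm[of t] N by (simp add: mult.commute)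
    then have "b t * m < int N * m" using bl[of t] by linarith
    then show ?thesis using m by simp
  qed
  consider (low) t where "1 \<le> t" "t < N" "b t = 0"
    | (high) t where "1 \<le> t" "t < N" "b t = int N - 1"
    | (mid) "\<forall>t\<in>{1..<N}. b t \<in> {1..int N - 2}"
  proof -
    have "b t \<in> {1..int N - 2}" if "b t \<noteq> 0" "b t \<noteq> int N - 1" for t
      using b0[of t] bN[of t] that by simp
    then show thesis using low high mid by (metis atLeastLessThan_iff)
  qed
  then show ?thesis
  proof cases
    case low
    then show ?thesis using rc[of t] bu[of t] r0[of t] by (intro exI[of _ t] exI[of _ "r t"]) auto
  next
    case high
    have "[int t * c = r t - m] (mod m)" using rc[of t] by (simp add: cong_def)
    moreover have "\<bar>r t - m\<bar> * int N \<le> m"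
      using bl[of t] high rm[of t] by (simp add: algebra_simps)
    ultimately show ?thesis using high by blast
  next
    case mid
    have "card {1..int N - 2} < card {1..<N}" using N by simp
    moreover have "b ` {1..<N} \<subseteq> {1..int N - 2}" using mid by blast
    ultimately have "\<not> inj_on b {1..<N}" using card_inj_on_le[of b "{1..<N}" "{1..int N - 2}"] by auto
    then obtain s t where st: "s \<in> {1..<N}" "t \<in> {1..<N}" "s < t" "b s = b t"
      by (metis inj_onI linorder_less_linear)
    have "[int t * c - int s * c = r t - r s] (mod m)" using rc cong_diff by blast
    then have "[int (t - s) * c = r t - r s] (mod m)"
      using st by (simp add: of_nat_diff left_diff_distrib)
    moreover have "\<bar>r t - r s\<bar> * int N \<le> m"
      using bl[of t] bu[of t] bl[of s] bu[of s] st(4) N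
      by (auto simp: abs_if left_diff_distrib)
    moreover have "1 \<le> t - s" "t - s < N" using st by auto
    ultimately show ?thesis by blast
  qed
qed

text \<open>The factor \<open>j\<close> is invertible modulo \<open>m\<close>, so
  \<open>e = 0\<close> would force \<open>m\<close> to divide \<open>c\<close>.\<close>

lemma ex_small_nonzero_multiple_mod:
  fixes c m :: int and N :: nat
  assumes "m > 0" "N \<ge> 2" "\<not> m dvd c" and cop: "\<And>j. 1 \<le> j \<Longrightarrow> j < N \<Longrightarrow> coprime m (int j)"
  obtains j e where "1 \<le> j" "j < N" "[int j * c = e] (mod m)" "\<bar>e\<bar> * int N \<le> m" "e \<noteq> 0"
proof -
  obtain j e where je: "1 \<le> j" "j < N" "[int j * c = e] (mod m)" "\<bar>e\<bar> * int N \<le> m"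
    using ex_small_multiple_mod[OF assms(1,2), of c] by blast
  have "e \<noteq> 0"
  proof
    assume "e = 0"
    then have "m dvd int j * c" using je by (simp add: cong_0_iff)
    then show False using cop[OF je(1,2)] assms(3) by (simp add: coprime_dvd_mult_right_iff)
  qed
  with je that show thesis by blast
qed

lemma coprime_if_less_least_prime_factor:
  assumes "m > 0" "j > 0" "j < least_prime_factor m"
  shows "coprime m j"
proof (rule ccontr)
  assume "\<not> coprime m j"
  then obtain p where p: "prime p" "p dvd m" "p dvd j"
    using prime_factor_nat[of "gcd m j"] by (auto simp: coprime_iff_gcd_eq_1)
  then have "least_prime_factor m \<le> p"
    unfolding least_prime_factor_def using assms by (intro Min_le) (auto simp: prime_factors_dvd)
  then show False using assms(2,3) dvd_imp_le[OF p(3)] by auto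
qed

lemma residue_ring_add_pow:
  assumes "m > 1" "x \<in> carrier (residue_ring (int m))"
  shows "[(i::nat)] \<cdot>\<^bsub>residue_ring (int m)\<^esub> x = (int i * x) mod int m"
proof -
  interpret residues "int m" "residue_ring (int m)" using assms by unfold_locales auto
  show ?thesis
    by (induction i) (simp_all add: res_zero_eq res_add_eq algebra_simps mod_simps)
qed

lemma is_AP_E:
  assumes "is_AP m n k a" "m > 1"
  obtains v c where
    "\<And>i j. i < k \<Longrightarrow> j < n \<Longrightarrow> a i j = (v j + int i * c j) mod int m"
    "\<exists>j<n. \<not> int m dvd c j"
proof -
  obtain v c where v: "v \<in> Zvec m n" and c: "c \<in> Zvec m n" "c \<noteq> Zvec_zero m n"
    and a: "\<forall>i<k. a i = Zvec_add m n v (Zvec_mult m n i c)"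
    using assms(1) unfolding is_AP_def by blast
  interpret residues "int m" "residue_ring (int m)" using assms by unfold_locales auto
  have cc: "c j \<in> carrier (residue_ring (int m))" if "j < n" for j
    using c(1) that by (auto simp: Zvec_def)
  have "a i j = (v j + int i * c j) mod int m" if "i < k" "j < n" for i j
    using a that residue_ring_add_pow[OF assms(2) cc]
    by (simp add: Zvec_add_def Zvec_mult_def res_add_eq mod_simps)
  moreover have "\<exists>j<n. \<not> int m dvd c j"
  proof (rule ccontr)
    assume *: "\<not> ?thesis"
    have "c j = Zvec_zero m n j" for j
    proof (cases "j < n")
      case True
      then have "0 \<le> c j" "c j < int m" "int m dvd c j"
        using cc[OF True] * by (auto simp: res_carrier_eq)
      then have "c j = 0" using zdvd_imp_le by fastforce
      then show ?thesis using True by (simp add: Zvec_zero_def res_zero_eq)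
    next
      case False
      \<comment> \<open>Outside the index set both vectors are extensional and take the value
        \<open>undefined\<close>.\<close>
      then show ?thesis using c(1) by (auto simp: Zvec_def Zvec_zero_def PiE_def extensional_def)
    qed
    then show False using c(2) by blast
  qed
  ultimately show thesis using that by blast
qed

text \<open>The fibres of \<open>v\<close> over \<open>D\<close> are disjoint and their sizes add up
  to \<open>n\<close>, so they leave no index uncovered.\<close>

lemma S_coordinate_mem:
  assumes v: "v \<in> S m D n" and D: "finite D" "card D dvd n" and j: "j < n"
  shows "v j \<in> D"
proof -
  define A where "A d = {j \<in> {..<n}. v j = d}" for d
  have "card (\<Union>d\<in>D. A d) = (\<Sum>d\<in>D. card (A d))"
    using D(1) by (intro card_UN_disjoint) (auto simp: A_def)
  also have "\<dots> = card D * (n div card D)" using v by (simp add: S_def A_def)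
  also have "\<dots> = card {..<n}" using D(2) by simp
  finally have "(\<Union>d\<in>D. A d) = {..<n}" by (intro card_subset_eq) (auto simp: A_def)
  then show ?thesis using j by (auto simp: A_def)
qed

text \<open>\<open>C\<close> stands for constancy along the progression. The fibre of
  \<open>x\<close> at position \<open>p\<close> consists of constant coordinates, so it is contained
  in the fibre at position \<open>i\<close>; both have size \<open>N\<close>, so they
  coincide.\<close>

lemma fibres_equal_if_constant_at_one_position:
  fixes a :: "nat \<Rightarrow> nat \<Rightarrow> int"
  assumes card: "\<And>i. i < k \<Longrightarrow> card {j \<in> {..<n}. a i j = x} = N"
    and const: "\<And>i j. i < k \<Longrightarrow> j < n \<Longrightarrow> C j \<Longrightarrow> a i j = a p j"
    and p: "p < k" "\<And>j. j < n \<Longrightarrow> a p j = x \<Longrightarrow> C j"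
    and ij: "i < k" "j < n" "a i j = x"
  shows "C j"
proof -
  have "{j \<in> {..<n}. a p j = x} = {j \<in> {..<n}. a i j = x}"
  proof (rule card_subset_eq)
    show "{j \<in> {..<n}. a p j = x} \<subseteq> {j \<in> {..<n}. a i j = x}"
      using const[OF ij(1)] p(2) by auto
  qed (use card p ij in auto)
  then show ?thesis using ij p(2) by blast
qed

text \<open>The combinatorial core over the integers: membership in \<open>S\<close> enters only
  through the allowed values and the equal fibre sizes.\<close>

lemma progression_coordinates_constant:
  fixes a :: "nat \<Rightarrow> nat \<Rightarrow> int" and v c :: "nat \<Rightarrow> int" and q :: int
  assumes k: "k \<ge> 4" "even k" and m: "m = int k * q - 1" and q: "q \<ge> 1"
    and cop: "\<And>j. 1 \<le> j \<Longrightarrow> j < k \<Longrightarrow> coprime m (int j)"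
    and a: "\<And>i j. i < k \<Longrightarrow> j < n \<Longrightarrow> a i j = (v j + int i * c j) mod m"
    and mem: "\<And>i j. i < k \<Longrightarrow> j < n \<Longrightarrow> a i j \<in> {0..(int k - 2) * q - 1} \<union> {(int k - 1) * q - 1}"
    and card: "\<And>i x. i < k \<Longrightarrow> x \<in> {0..(int k - 2) * q - 1} \<union> {(int k - 1) * q - 1} \<Longrightarrow>
                 card {j \<in> {..<n}. a i j = x} = N"
    and j: "j < n"
  shows "m dvd c j"
proof -
  define d where "d = (int k - 1) * q - 1"
  have "int k * q \<ge> 4 * 1" using k q by (intro mult_mono) auto
  then have m0: "m > 0" using m by linarith
  have const: "a i j = a p j" if "i < k" "p < k" "j < n" "m dvd c j" for i p j
    using that by (auto simp: a mult.left_commute[of _ m] elim!: dvdE)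
  have shift: "a p' j = (a p j + (int p' * c j - int p * c j)) mod m"
    if "p < k" "p' < k" "j < n" for p p' j
    using that by (simp add: a mod_add_left_eq)
  have start: "m dvd c j" if j: "j < n" and ad: "a 0 j = d" for j
  proof (rule ccontr)
    assume "\<not> m dvd c j"
    then obtain t e where t: "1 \<le> t" "t < k" "[int t * c j = e] (mod m)" "\<bar>e\<bar> * int k \<le> m" "e \<noteq> 0"
      using ex_small_nonzero_multiple_mod[OF m0, of k "c j"] k cop by auto
    have "\<bar>e\<bar> * int k < q * int k" using t(4) m by (simp add: algebra_simps)
    then have e: "\<bar>e\<bar> < q" using k by simp
    have "a t j = (d + int t * c j) mod m" using shift[of 0 t j] t j ad k by simp
    also have "\<dots> = (d + e) mod m" using t(3) by (metis cong_def mod_add_right_eq)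
    also have "\<dots> = d + e"
    proof (rule mod_pos_pos_trivial)
      have "(int k - 1) * q \<ge> 2 * q" using k q by (intro mult_right_mono) auto
      then show "0 \<le> d + e" using e q unfolding d_def by linarith
      show "d + e < m" using e unfolding d_def m by (simp add: algebra_simps)
    qed
    \<comment> \<open>As \<open>\<bar>e\<bar> < q\<close> and \<open>e \<noteq> 0\<close>, the value
      \<open>d + e\<close> exceeds \<open>(k - 2) * q - 1\<close> and differs from \<open>d\<close>,
      so it is not allowed.\<close>
    finally show False using mem[OF t(2) j] e t(5) by (auto simp: d_def algebra_simps)
  qed
  have no_d: "m dvd c j" if "i < k" "j < n" "a i j = d" for i j
  proof (rule fibres_equal_if_constant_at_one_position[of k n a d N "\<lambda>j. m dvd c j" 0 i j])
    show "card {j \<in> {..<n}. a i j = d} = N" if "i < k" for i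
      using that by (intro card) (auto simp: d_def)
    show "a i j = a 0 j" if "i < k" "j < n" "m dvd c j" for i j
      by (rule const) (use that k in auto)
  qed (use that start k in auto)
  have middle: "m dvd c j"
    if j: "j < n" and x: "a (k div 2) j = x" "x < (int k - 2) * q" and le: "\<forall>i<k. a i j \<le> x" for x j
  proof (rule ccontr)
    assume nd: "\<not> m dvd c j"
    obtain h where h: "k = 2 * h" "h \<ge> 2" using k by (auto elim!: evenE)
    obtain t e where t: "1 \<le> t" "t < h" "[int t * c j = e] (mod m)" "\<bar>e\<bar> * int h \<le> m" "e \<noteq> 0"
      using ex_small_nonzero_multiple_mod[OF m0 h(2) nd] cop h by auto
    have "m = (2 * q) * int h - 1" using m h by simp
    then have "\<bar>e\<bar> * int h < (2 * q) * int h" using t(4) by linarith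
    then have e: "\<bar>e\<bar> < 2 * q" using h by simp
    \<comment> \<open>The direction is chosen so that moving from position \<open>h\<close> to
      \<open>p\<close> adds \<open>\<bar>e\<bar>\<close>; since \<open>t < h\<close>, both choices
      stay inside the progression.\<close>
    define p where "p = (if e > 0 then h + t else h - t)"
    have p: "p < k" using t h by (auto simp: p_def)
    have "0 \<le> x" using x(1) a[of "k div 2" j] j m0 k by auto
    have "[int p * c j - int h * c j = \<bar>e\<bar>] (mod m)"
    proof (cases "e > 0")
      case True
      then show ?thesis using t(3) by (simp add: p_def algebra_simps)
    next
      case False
      then have "int p * c j - int h * c j = - (int t * c j)"
        using t by (simp add: p_def of_nat_diff algebra_simps)
      then show ?thesis using t(3) False by (simp add: cong_minus_minus_iff)
    qed
    then have "(x + (int p * c j - int h * c j)) mod m = (x + \<bar>e\<bar>) mod m"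
      by (metis cong_def mod_add_right_eq)
    moreover have "a p j = (x + (int p * c j - int h * c j)) mod m"
      using shift[of h p j] p h j x(1) by simp
    \<comment> \<open>No wrap-around: the sum is at most
      \<open>((k - 2) * q - 1) + (2 * q - 1) = m - 1\<close>.\<close>
    moreover have "(x + \<bar>e\<bar>) mod m = x + \<bar>e\<bar>"
      using \<open>0 \<le> x\<close> x(2) e by (intro mod_pos_pos_trivial) (auto simp: m algebra_simps)
    ultimately have "a p j = x + \<bar>e\<bar>" by simp
    then show False using le p t(5) by force
  qed
  \<comment> \<open>Downward sweep: each step removes the largest value still open to nonconstant
    coordinates.\<close>
  have below: "\<forall>i<k. \<forall>j<n. \<not> m dvd c j \<longrightarrow> a i j < (int k - 2) * q - int s" for s :: nat
  proof (induction s)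
    case 0
    then show ?case using mem no_d by (fastforce simp: d_def)
  next
    case (Suc s)
    define x where "x = (int k - 2) * q - int s - 1"
    have "m dvd c j" if ij: "i < k" "j < n" "a i j = x" for i j
    proof (rule fibres_equal_if_constant_at_one_position[of k n a x N "\<lambda>j. m dvd c j" "k div 2" i j])
      \<comment> \<open>For large \<open>s\<close> the number \<open>x\<close> is negative and has
        no prescribed fibre size; being attained rules this out.\<close>
      have "x \<ge> 0" using ij a[of i j] m0 by auto
      then show "card {j \<in> {..<n}. a i j = x} = N" if "i < k" for i
        using that by (intro card) (auto simp: x_def)
      show "m dvd c j" if "j < n" "a (k div 2) j = x" for j
      proof (rule ccontr)
        assume "\<not> m dvd c j"
        moreover from this have "\<forall>i<k. a i j \<le> x" using Suc that(1) by (force simp: x_def)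
        ultimately show False using middle[OF that] by (auto simp: x_def)
      qed
      show "a i j = a (k div 2) j" if "i < k" "j < n" "m dvd c j" for i j
        by (rule const) (use that k in auto)
    qed (use ij k in auto)
    then show ?case using Suc unfolding x_def by force
  qed
  show ?thesis
  proof (rule ccontr)
    assume "\<not> m dvd c j"
    \<comment> \<open>After \<open>(k - 2) * q\<close> steps of the sweep no nonnegative value
      remains.\<close>
    then have "a 0 j < (int k - 2) * q - int (nat ((int k - 2) * q))"
      by (intro below[rule_format]) (use j k in auto)
    moreover have "a 0 j \<ge> 0" using a[of 0 j] j k m0 by auto
    ultimately show False using k q by simp
  qed
qed

theorem theorem2p3:
  fixes k m n :: nat
  assumes "k \<ge> 4" and "even k"
    and "m \<ge> 2" and "[int m = -1] (mod int k)"
    and "least_prime_factor m \<ge> k"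
    and "n > 0" and "(\<lfloor>(real k - 2) / real k * real m\<rfloor> + 2) dvd int n"
  shows "\<not> (\<exists>a. is_AP m n k a \<and> (\<forall>i<k. a i \<in> S m (Dset k m) n))"
proof
  assume "\<exists>a. is_AP m n k a \<and> (\<forall>i<k. a i \<in> S m (Dset k m) n)"
  then obtain a where AP: "is_AP m n k a" and aS: "\<And>i. i < k \<Longrightarrow> a i \<in> S m (Dset k m) n"
    by blast
  have "int k dvd int m + 1" using assms(4) by (simp add: cong_iff_dvd_diff)
  then obtain q where "int m + 1 = int k * q" by (elim dvdE)
  then have m: "int m = int k * q - 1" by simp
  have "int k * q > 0" using m assms(3) by linarith
  then have q: "q \<ge> 1" using assms(1) by (simp add: zero_less_mult_iff)
  have rm: "real m = real k * real_of_int q - 1"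
    by (metis m of_int_1 of_int_diff of_int_mult of_int_of_nat_eq)
  have fl: "\<lfloor>(real k - 2) / real k * real m\<rfloor> = (int k - 2) * q - 1"
  proof (rule floor_unique)
    \<comment> \<open>The subtracted fraction lies in the interval from 0 to 1, so rounding down
      lands on \<open>(k - 2) * q - 1\<close>.\<close>
    have eq: "(real k - 2) / real k * real m = (real k - 2) * q - (real k - 2) / real k"
      using assms(1) unfolding rm by (simp add: field_simps)
    have "0 < (real k - 2) / real k" "(real k - 2) / real k \<le> 1" using assms(1) by auto
    then show "of_int ((int k - 2) * q - 1) \<le> (real k - 2) / real k * real m"
      "(real k - 2) / real k * real m < of_int ((int k - 2) * q - 1) + 1"
      unfolding eq by simp_all
  qed
  have "(int k - 1) * int m - 1 = int k * ((int k - 1) * q - 1)"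
    unfolding m by (simp add: algebra_simps)
  then have D: "Dset k m = {0..(int k - 2) * q - 1} \<union> {(int k - 1) * q - 1}"
    unfolding Dset_def fl using assms(1) by simp
  have "(int k - 2) * q > 0" using assms(1) q by simp
  \<comment> \<open>The extra element is not in the interval, so \<open>card (Dset k m)\<close> is
    exactly the number assumed to divide \<open>n\<close>.\<close>
  moreover have "(int k - 1) * q - 1 \<notin> {0..(int k - 2) * q - 1}" using q by (simp add: algebra_simps)
  ultimately have "int (card (Dset k m)) = (int k - 2) * q - 1 + 2"
    unfolding D by simp
  then have "card (Dset k m) dvd n" using assms(7) unfolding fl by (metis int_dvd_int_iff)
  then have mem: "a i j \<in> Dset k m" if "i < k" "j < n" for i j
    using S_coordinate_mem[OF aS] that by (simp add: D)
  obtain v c where a: "\<And>i j. i < k \<Longrightarrow> j < n \<Longrightarrow> a i j = (v j + int i * c j) mod int m"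
    and c: "\<exists>j<n. \<not> int m dvd c j"
    using is_AP_E[OF AP] assms(3) by auto
  have "int m dvd c j" if "j < n" for j
  proof (rule progression_coordinates_constant[OF assms(1,2) m q _ a _ _ that])
    show "coprime (int m) (int t)" if "1 \<le> t" "t < k" for t
      using coprime_if_less_least_prime_factor[of m t] that assms(3,5) by simp
    show "card {j \<in> {..<n}. a i j = x} = n div card (Dset k m)"
      if "i < k" "x \<in> {0..(int k - 2) * q - 1} \<union> {(int k - 1) * q - 1}" for i x
      using aS[OF that(1)] that(2) unfolding S_def D[symmetric] by blast
  qed (use mem D in auto)
  with c show False by blast
qed

end
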